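(* Let $d\geqslant 2$ and let $n$ be a positive integer. If $d\geqslant 3$, then the maximum of $p_{A_d}(\boldsymbol{\lambda})$ over all $A_d$-partitions $\boldsymbol{\lambda}$ of $n$ is attained at the partition consisting of $\lfloor n/2^d\rfloor$ parts equal to $2^d$ and $n-2^d\lfloor n/2^d\rfloor$ parts equal to $1$. If $d=2$, this maximum is attained at the following partitions (parts with multiplicities written as exponents): $(4^{\lfloor n/4\rfloor},1^{n-4\lfloor n/4\rfloor})$ for all $n$; $(9,4^{\lfloor (n-9)/4\rfloor},1^{n-4\lfloor (n-9)/4\rfloor-9})$ if $n\equiv1,2,3\pmod 4$ and $n\geqslant 9$; $(9^2,4^{\lfloor (n-18)/4\rfloor},1^{n-4\lfloor (n-18)/4\rfloor-18})$ if $n\equiv 2,3\pmod 4$ and $n\geqslant 18$; $(9^3,4^{\lfloor (n-27)/4\rfloor},1^{n-4\lfloor (n-27)/4\rfloor-27})$ if $n\equiv 3\pmod 4$ and $n\geqslant 27$. In particular, for every $d\geqslant2$, $$\max\{p_{A_d}(\boldsymbol{\lambda}):\boldsymbol{\lambda}\text{ an } A_d\text{-partition of } n\}=2^{\lfloor n/2^d\rfloor}.$$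
   Context: For an integer $d\geqslant2$, let $A_d=\{n^d:n\in\mathbb{N}_+\}$. An $A_d$-partition of $n$ is a partition of $n$ all of whose parts lie in $A_d$, and $p_{A_d}(n)$ is the number of such partitions. For an $A_d$-partition $\boldsymbol{\lambda}=(\lambda_1,\ldots,\lambda_j)$, the extended function is $p_{A_d}(\boldsymbol{\lambda})=\prod_{i=1}^j p_{A_d}(\lambda_i)$. The notation $(a^k,b^l,\ldots)$ means the partition with $k$ parts equal to $a$, $l$ parts equal to $b$, etc. *)

theory Defs
  imports Main "HOL-Library.Multiset"
begin

definition partitions :: "nat \<Rightarrow> nat multiset set" where
  "partitions n = {lam. 0 \<notin># lam \<and> \<Sum>\<^sub># lam = n}"

definition A_partitions :: "nat set \<Rightarrow> nat \<Rightarrow> nat multiset set" where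
  "A_partitions A n = {lam \<in> partitions n. set_mset lam \<subseteq> A}"

definition powers :: "nat \<Rightarrow> nat set" where
  "powers d = {m ^ d | m. m > 0}"

definition p :: "nat set \<Rightarrow> nat \<Rightarrow> nat" where
  "p A n = card (A_partitions A n)"

definition p_ext :: "nat set \<Rightarrow> nat multiset \<Rightarrow> nat" where
  "p_ext A lam = (\<Prod>k\<in>#lam. p A k)"

text \<open>By the lemmas below, the set of values is finite, and for the sets \<open>powers d\<close> it is
  nonempty, so that \<open>Max\<close> is a genuine maximum.\<close>

definition max_p :: "nat set \<Rightarrow> nat \<Rightarrow> nat" where
  "max_p A n = Max (p_ext A ` A_partitions A n)"

definition max_attained_at :: "nat set \<Rightarrow> nat \<Rightarrow> nat multiset \<Rightarrow> bool" where
  "max_attained_at A n lam \<longleftrightarrow> lam \<in> A_partitions A n \<and> p_ext A lam = max_p A n"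

lemma size_le_sum_mset:
  fixes lam :: "nat multiset"
  assumes "0 \<notin># lam"
  shows "size lam \<le> \<Sum>\<^sub># lam"
  using assms by (induction lam) auto

lemma finite_A_partitions: "finite (A_partitions A n)"
proof -
  have "A_partitions A n \<subseteq> mset ` {xs. set xs \<subseteq> {..n} \<and> length xs \<le> n}"
  proof
    fix lam assume "lam \<in> A_partitions A n"
    then have nz: "0 \<notin># lam" and s: "\<Sum>\<^sub># lam = n"
      by (auto simp: A_partitions_def partitions_def)
    obtain xs where xs: "lam = mset xs"
      by (metis ex_mset)
    have "length xs \<le> n"
      using size_le_sum_mset[OF nz] s xs by simp
    moreover have "set xs \<subseteq> {..n}"
      using s xs by (auto simp: sum_mset_sum_list intro: member_le_sum_list)
    ultimately show "lam \<in> mset ` {xs. set xs \<subseteq> {..n} \<and> length xs \<le> n}"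
      using xs by blast
  qed
  moreover have "finite {xs. set xs \<subseteq> {..n} \<and> length xs \<le> n}"
    by (rule finite_lists_length_le) simp
  ultimately show ?thesis
    by (meson finite_imageI finite_subset)
qed

lemma A_partitions_powers_nonempty: "A_partitions (powers d) n \<noteq> {}"
proof -
  have "1 \<in> powers d"
    unfolding powers_def by (auto intro: exI[of _ 1])
  then have "replicate_mset n 1 \<in> A_partitions (powers d) n"
    by (auto simp: A_partitions_def partitions_def split: if_splits)
  then show ?thesis by blast
qed

end

theory Submission imports Defs begin

text \<open>
  A partition of \<open>n\<close> into \<open>d\<close>-th powers is determined by its parts other than \<open>1\<close>. Dividing these
  by \<open>2 ^ d\<close> with rounding down is injective on the part sizes, because consecutive \<open>d\<close>-th powers
  \<open>m ^ d\<close> with \<open>m \<ge> 2\<close> differ by at least \<open>2 ^ d\<close>; it yields a multiset of positive integers with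
  sum at most \<open>n div 2 ^ d\<close>. There are at most \<open>2 ^ k\<close> multisets of positive integers with sum at
  most \<open>k\<close>, so \<open>p n \<le> 2 ^ (n div 2 ^ d)\<close> for every \<open>n\<close>. The exponent is superadditive in \<open>n\<close>,
  so the same bound holds for the extended function, and it is attained since \<open>p\<close> takes the
  values \<open>1\<close>, \<open>2\<close> at \<open>1\<close>, \<open>2 ^ d\<close>, and \<open>4\<close> at \<open>9\<close> if \<open>d = 2\<close>.
\<close>

section \<open>Counting multisets of positive integers with bounded sum\<close>

lemma finite_multisets_sum_le:
  "finite {M :: nat multiset. 0 \<notin># M \<and> \<Sum>\<^sub># M \<le> k}"
proof -
  have "{M :: nat multiset. 0 \<notin># M \<and> \<Sum>\<^sub># M \<le> k} \<subseteq> (\<Union>j\<le>k. A_partitions UNIV j)"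
    by (auto simp: A_partitions_def partitions_def)
  then show ?thesis
    by (rule finite_subset) (simp add: finite_A_partitions)
qed

text \<open>Each step of the induction at most doubles the count: a multiset of sum exactly
  \<open>Suc k\<close> loses some part and becomes one of sum at most \<open>k\<close>, from which
  it can be rebuilt.\<close>

lemma card_multisets_sum_le:
  "card {M :: nat multiset. 0 \<notin># M \<and> \<Sum>\<^sub># M \<le> k} \<le> 2 ^ k"
proof (induction k)
  case 0
  have "{M :: nat multiset. 0 \<notin># M \<and> \<Sum>\<^sub># M \<le> 0} \<subseteq> {{#}}"
  proof
    fix M :: "nat multiset" assume "M \<in> {M. 0 \<notin># M \<and> \<Sum>\<^sub># M \<le> 0}"
    then show "M \<in> {{#}}" by (cases M) auto
  qed
  then have "card {M :: nat multiset. 0 \<notin># M \<and> \<Sum>\<^sub># M \<le> 0} \<le> card {{#} :: nat multiset}"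
    by (rule card_mono[rotated]) simp
  then show ?case by simp
next
  case (Suc k)
  let ?P = "\<lambda>k. {M :: nat multiset. 0 \<notin># M \<and> \<Sum>\<^sub># M \<le> k}"
  \<comment> \<open>A part removed from a multiset of sum \<open>Suc k\<close> is recovered from the sum of the others.\<close>
  let ?f = "\<lambda>M. add_mset (Suc k - \<Sum>\<^sub># M) M"
  have sub: "?P (Suc k) \<subseteq> ?P k \<union> ?f ` ?P k"
  proof
    fix M :: "nat multiset" assume M: "M \<in> ?P (Suc k)"
    show "M \<in> ?P k \<union> ?f ` ?P k"
    proof (cases "\<Sum>\<^sub># M \<le> k")
      case True
      with M show ?thesis by simp
    next
      case False
      with M have s: "\<Sum>\<^sub># M = Suc k" by simp
      then have "M \<noteq> {#}" by auto
      then obtain a N where aN: "M = add_mset a N" by (meson multiset_cases)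
      with M s have "N \<in> ?P k" "M = ?f N" by auto
      then show ?thesis by blast
    qed
  qed
  have "card (?P (Suc k)) \<le> card (?P k \<union> ?f ` ?P k)"
    by (rule card_mono[OF _ sub]) (simp add: finite_multisets_sum_le)
  also have "\<dots> \<le> card (?P k) + card (?f ` ?P k)"
    by (rule card_Un_le)
  also have "\<dots> \<le> card (?P k) + card (?P k)"
    by (intro add_left_mono card_image_le finite_multisets_sum_le)
  also have "\<dots> \<le> 2 ^ Suc k" using Suc.IH by simp
  finally show ?case .
qed

section \<open>Gaps between consecutive powers\<close>

text \<open>With two factors split off, both \<open>m ^ k\<close> and \<open>2 ^ k\<close> are
  bounded by \<open>Suc m ^ k\<close>, and the quadratic case remains:
  \<open>4 \<le> 2 * m + 1\<close>, which needs \<open>m \<ge> 2\<close>.\<close>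

lemma power_add_two_power_le_Suc_power:
  fixes d m :: nat
  assumes "d \<ge> 2" "m \<ge> 2"
  shows "m ^ d + 2 ^ d \<le> Suc m ^ d"
proof -
  obtain k where k: "d = k + 2" using assms(1) by (metis add.commute le_Suc_ex)
  have "m ^ d + 2 ^ d = m ^ k * m\<^sup>2 + 2 ^ k * 4" by (simp add: k power_add power2_eq_square)
  also have "\<dots> \<le> Suc m ^ k * m\<^sup>2 + Suc m ^ k * 4"
    using assms(2) by (intro add_mono mult_right_mono power_mono) auto
  also have "\<dots> = Suc m ^ k * (m\<^sup>2 + 4)" by (simp add: algebra_simps)
  also have "\<dots> \<le> Suc m ^ k * (Suc m)\<^sup>2"
    using assms(2) by (intro mult_left_mono) (simp_all add: power2_eq_square)
  also have "\<dots> = Suc m ^ d" by (simp only: k power_add)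
  finally show ?thesis .
qed

lemma power_div_two_power_less:
  fixes d m k :: nat
  assumes "d \<ge> 2" "m \<ge> 2" "m < k"
  shows "m ^ d div 2 ^ d < k ^ d div 2 ^ d"
proof -
  \<comment> \<open>Adding the divisor raises the quotient by exactly one.\<close>
  have "m ^ d div 2 ^ d < (m ^ d + 2 ^ d) div 2 ^ d" by (subst div_add_self2) simp_all
  also have "\<dots> \<le> k ^ d div 2 ^ d"
    using power_add_two_power_le_Suc_power[OF assms(1,2)] power_mono[of "Suc m" k d] assms(3)
    by (intro div_le_mono) simp
  finally show ?thesis .
qed

lemma inj_on_div_two_power:
  fixes d :: nat
  assumes "d \<ge> 2"
  shows "inj_on (\<lambda>a. a div 2 ^ d) (powers d - {1})"
proof (rule inj_onI)
  fix a b assume "a \<in> powers d - {1}" "b \<in> powers d - {1}" and eq: "a div 2 ^ d = b div 2 ^ d"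
  then obtain k m where km: "a = k ^ d" "b = m ^ d" "k > 0" "m > 0" "k \<noteq> 1" "m \<noteq> 1"
    by (auto simp: powers_def)
  then have "k \<ge> 2" "m \<ge> 2" by auto
  then have "\<not> k < m" "\<not> m < k"
    using power_div_two_power_less[OF assms] eq km(1,2) by (metis less_irrefl)+
  then show "a = b" using km by simp
qed

section \<open>Upper bounds for \<open>p\<close> and \<open>p_ext\<close>\<close>

text \<open>Pooled remainders can only add to the quotient. This bounds both the sum of an encoded
  partition and, later, the exponent of a product.\<close>

lemma sum_mset_div_le: "(\<Sum>a\<in>#M. a div q) \<le> \<Sum>\<^sub># M div (q :: nat)"
proof (induction M)
  case (add a M)
  have "a div q + \<Sum>\<^sub># M div q \<le> (a + \<Sum>\<^sub># M) div q"
    by (subst div_add1_eq[of a "\<Sum>\<^sub># M"]) simp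
  with add show ?case by simp
qed simp

lemma image_mset_eq_if_inj_on:
  assumes "image_mset f M = image_mset f N" "inj_on f (set_mset M \<union> set_mset N)"
  shows "M = N"
  using image_mset_eq_image_mset_plusD[of f M N "{#}"] assms by auto

lemma filter_neq_plus_replicate:
  "filter_mset (\<lambda>x. x \<noteq> a) M + replicate_mset (count M a) a = M"
  by (rule multiset_eqI) auto

text \<open>Makes discarding the ones reversible among partitions of a fixed number.\<close>

lemma count_one_eq:
  fixes M :: "nat multiset"
  shows "count M 1 = \<Sum>\<^sub># M - \<Sum>\<^sub># (filter_mset (\<lambda>x. x \<noteq> 1) M)"
  by (subst (2) filter_neq_plus_replicate[of 1 M, symmetric]) (simp only: sum_mset.union, simp)

lemma p_powers_le:
  fixes d n :: nat
  assumes "d \<ge> 2"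
  shows "p (powers d) n \<le> 2 ^ (n div 2 ^ d)"
proof -
  let ?q = "2 ^ d :: nat"
  \<comment> \<open>Ones are dropped before dividing: their quotient would be \<open>0\<close>,
    which \<open>?P\<close> excludes.\<close>
  let ?h = "\<lambda>M. filter_mset (\<lambda>x. x \<noteq> 1) M :: nat multiset"
  let ?g = "\<lambda>M. image_mset (\<lambda>a. a div ?q) (?h M)"
  let ?P = "{M :: nat multiset. 0 \<notin># M \<and> \<Sum>\<^sub># M \<le> n div ?q}"
  have "inj_on ?g (A_partitions (powers d) n)"
  proof (rule inj_onI)
    fix M N assume MN: "M \<in> A_partitions (powers d) n" "N \<in> A_partitions (powers d) n"
      and eq: "?g M = ?g N"
    have sub: "set_mset (?h M) \<subseteq> powers d - {1}" "set_mset (?h N) \<subseteq> powers d - {1}"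
      using MN by (auto simp: A_partitions_def)
    have "?h M = ?h N"
      by (rule image_mset_eq_if_inj_on[OF eq inj_on_subset[OF inj_on_div_two_power[OF assms]]])
        (use sub in blast)
    moreover have "\<Sum>\<^sub># M = \<Sum>\<^sub># N"
      using MN by (simp add: A_partitions_def partitions_def)
    \<comment> \<open>The parts other than \<open>1\<close> agree, and the common total fixes the
      number of ones.\<close>
    ultimately show "M = N"
      by (metis filter_neq_plus_replicate count_one_eq)
  qed
  moreover have "?g ` A_partitions (powers d) n \<subseteq> ?P"
  proof
    fix X assume "X \<in> ?g ` A_partitions (powers d) n"
    then obtain M where M: "M \<in> A_partitions (powers d) n" and X: "X = ?g M" by blast
    have "a div ?q \<noteq> 0" if "a \<in># ?h M" for a
    proof -
      from that M obtain m where m: "a = m ^ d" "m > 0" "m \<noteq> 1"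
        by (auto simp: A_partitions_def powers_def)
      then have "2 ^ d \<le> a" by (simp add: power_mono)
      then show ?thesis by (simp add: div_eq_0_iff)
    qed
    then have "0 \<notin># X" using X by fastforce
    moreover have "\<Sum>\<^sub># X \<le> n div ?q"
    proof -
      have "\<Sum>\<^sub># (?h M) \<le> \<Sum>\<^sub># M"
        by (metis filter_neq_plus_replicate le_add1 sum_mset.union)
      also have "\<Sum>\<^sub># M = n" using M by (simp add: A_partitions_def partitions_def)
      finally have "\<Sum>\<^sub># (?h M) div ?q \<le> n div ?q" by (rule div_le_mono)
      with sum_mset_div_le X show ?thesis by (metis order_trans)
    qed
    ultimately show "X \<in> ?P" by simp
  qed
  ultimately have "card (A_partitions (powers d) n) \<le> card ?P"
    using finite_multisets_sum_le by (rule card_inj_on_le)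
  with card_multisets_sum_le show ?thesis unfolding p_def by (rule order_trans[rotated])
qed

lemma p_ext_powers_le:
  fixes d n :: nat
  assumes "d \<ge> 2" "M \<in> A_partitions (powers d) n"
  shows "p_ext (powers d) M \<le> 2 ^ (n div 2 ^ d)"
proof -
  \<comment> \<open>Multiplying the bounds for the single parts adds their exponents.\<close>
  have "p_ext (powers d) M \<le> 2 ^ (\<Sum>a\<in>#M. a div 2 ^ d)"
    unfolding p_ext_def
  proof (induction M)
    case (add a M)
    then show ?case using p_powers_le[OF assms(1), of a] by (simp add: power_add mult_mono)
  qed simp
  also have "\<dots> \<le> 2 ^ (\<Sum>\<^sub># M div 2 ^ d)"
    by (intro power_increasing sum_mset_div_le) simp
  finally show ?thesis using assms(2) by (simp add: A_partitions_def partitions_def)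
qed

section \<open>Partitions attaining the bound\<close>

text \<open>One partition meeting the upper bound settles the maximum, so every extremal claim
  reduces to evaluating \<open>p_ext\<close> at a single partition.\<close>

lemma max_p_powers_eqI:
  fixes d n :: nat
  assumes "d \<ge> 2" "M \<in> A_partitions (powers d) n" "p_ext (powers d) M = 2 ^ (n div 2 ^ d)"
  shows "max_p (powers d) n = 2 ^ (n div 2 ^ d)"
  unfolding max_p_def
proof (rule Max_eqI)
  show "finite (p_ext (powers d) ` A_partitions (powers d) n)"
    by (simp add: finite_A_partitions)
  show "y \<le> 2 ^ (n div 2 ^ d)" if "y \<in> p_ext (powers d) ` A_partitions (powers d) n" for y
    using that p_ext_powers_le[OF assms(1)] by blast
  show "2 ^ (n div 2 ^ d) \<in> p_ext (powers d) ` A_partitions (powers d) n"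
    using assms(2,3) by (metis imageI)
qed

lemma max_attained_at_powersI:
  fixes d n :: nat
  assumes "d \<ge> 2" "M \<in> A_partitions (powers d) n" "p_ext (powers d) M = 2 ^ (n div 2 ^ d)"
  shows "max_attained_at (powers d) n M"
  using max_p_powers_eqI[OF assms] assms(2,3) by (simp add: max_attained_at_def)

lemma power_in_powers: "m > 0 \<Longrightarrow> m ^ d \<in> powers d"
  unfolding powers_def by blast

lemma one_in_powers: "1 \<in> powers d"
  using power_in_powers[of 1 d] by simp

lemma card_le_p:
  assumes "S \<subseteq> A_partitions A n"
  shows "card S \<le> p A n"
  unfolding p_def using finite_A_partitions assms by (rule card_mono)

text \<open>At \<open>1\<close>, at \<open>2 ^ d\<close> and, for squares, at \<open>9\<close>, the
  general upper bound is already the exact value, so it suffices to exhibit enough distinct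
  partitions.\<close>

lemma p_powers_one:
  assumes "d \<ge> 2"
  shows "p (powers d) 1 = 1"
proof (rule antisym)
  have "(1 :: nat) < 2 ^ d" using assms by (intro one_less_power) simp_all
  then show "p (powers d) 1 \<le> 1" using p_powers_le[OF assms, of 1] by simp
  have "{{#1#}} \<subseteq> A_partitions (powers d) 1"
    using one_in_powers by (simp add: A_partitions_def partitions_def)
  from card_le_p[OF this] show "1 \<le> p (powers d) 1" by simp
qed

lemma p_powers_two_power:
  assumes "d \<ge> 2"
  shows "p (powers d) (2 ^ d) = 2"
proof (rule antisym)
  show "p (powers d) (2 ^ d) \<le> 2" using p_powers_le[OF assms, of "2 ^ d"] by simp
  have gt: "(1 :: nat) < 2 ^ d" using assms by (intro one_less_power) simp_all
  let ?M = "{#2 ^ d#} :: nat multiset" and ?N = "replicate_mset (2 ^ d) 1 :: nat multiset"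
  have "{?M, ?N} \<subseteq> A_partitions (powers d) (2 ^ d)"
    using one_in_powers power_in_powers[of 2 d]
    by (simp add: A_partitions_def partitions_def)
  moreover have "?M \<noteq> ?N"
    using gt by (metis size_replicate_mset size_single less_irrefl)
  ultimately show "2 \<le> p (powers d) (2 ^ d)" by (metis card_2_iff card_le_p)
qed

lemma four_nine_in_powers: "4 \<in> powers 2" "9 \<in> powers 2"
  using power_in_powers[of 2 2] power_in_powers[of 3 2] by simp_all

lemma p_powers_two_nine: "p (powers 2) 9 = 4"
proof (rule antisym)
  show "p (powers 2) 9 \<le> 4" using p_powers_le[of 2 9] by simp
  let ?S = "{{#9#}, {#4, 4, 1#}, add_mset 4 (replicate_mset 5 1), replicate_mset 9 1} :: nat multiset set"
  have "?S \<subseteq> A_partitions (powers 2) 9"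
    using one_in_powers[of 2] four_nine_in_powers by (simp add: A_partitions_def partitions_def)
  \<comment> \<open>The sizes \<open>1\<close>, \<open>3\<close>, \<open>6\<close>, \<open>9\<close>
    tell the four partitions apart.\<close>
  moreover have "card (size ` ?S) = 4" by simp
  then have "4 \<le> card ?S" by (metis card_image_le finite.emptyI finite.insertI)
  ultimately show "4 \<le> p (powers 2) 9" using card_le_p by (metis order_trans)
qed

lemma p_ext_plus: "p_ext A (M + N) = p_ext A M * p_ext A N"
  by (simp add: p_ext_def)

lemma p_ext_replicate: "p_ext A (replicate_mset k a) = p A a ^ k"
  by (simp add: p_ext_def)

text \<open>Separates the structural membership proof, which produces an unsimplified total, from
  the arithmetic identifying that total.\<close>

lemma A_partitions_eqI: "M \<in> A_partitions A m \<Longrightarrow> m = n \<Longrightarrow> M \<in> A_partitions A n"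
  by simp

lemma plus_in_A_partitions:
  "M \<in> A_partitions A m \<Longrightarrow> N \<in> A_partitions A n \<Longrightarrow> M + N \<in> A_partitions A (m + n)"
  by (auto simp: A_partitions_def partitions_def)

lemma replicate_in_A_partitions:
  "a \<in> A \<Longrightarrow> a > 0 \<Longrightarrow> replicate_mset k a \<in> A_partitions A (k * a)"
  by (simp add: A_partitions_def partitions_def)

lemma replicate_partition_in_A_partitions:
  "replicate_mset (n div 2 ^ d) (2 ^ d) + replicate_mset (n - 2 ^ d * (n div 2 ^ d)) 1
    \<in> A_partitions (powers d) n"
proof (rule A_partitions_eqI)
  show "replicate_mset (n div 2 ^ d) (2 ^ d) + replicate_mset (n - 2 ^ d * (n div 2 ^ d)) 1
      \<in> A_partitions (powers d) (n div 2 ^ d * 2 ^ d + (n - 2 ^ d * (n div 2 ^ d)) * 1)"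
    by (intro plus_in_A_partitions replicate_in_A_partitions power_in_powers one_in_powers) simp_all
  show "n div 2 ^ d * 2 ^ d + (n - 2 ^ d * (n div 2 ^ d)) * 1 = n"
    by (simp add: mult.commute[of _ "2 ^ d"])
qed

text \<open>The number \<open>k\<close> of ones is arbitrary, since each contributes a factor
  \<open>1\<close>.\<close>

lemma p_ext_replicate_partition:
  assumes "d \<ge> 2"
  shows "p_ext (powers d)
    (replicate_mset (n div 2 ^ d) (2 ^ d) + replicate_mset k 1) = 2 ^ (n div 2 ^ d)"
  unfolding p_ext_plus p_ext_replicate p_powers_one[OF assms] p_powers_two_power[OF assms] by simp

text \<open>Trading \<open>4, 4, 1\<close> for a \<open>9\<close> preserves both the sum and the
  product, as \<open>p\<close> is \<open>4\<close> at \<open>9\<close> and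
  \<open>2 * 2 * 1 = 4\<close>. Each trade uses up a one, and \<open>n mod 4\<close> of them are
  available.\<close>

lemma max_attained_at_squares:
  assumes "9 * k \<le> n" "k \<le> n mod 4"
  shows "max_attained_at (powers 2) n
    (replicate_mset k 9 + replicate_mset ((n - 9 * k) div 4) 4
      + replicate_mset (n - 4 * ((n - 9 * k) div 4) - 9 * k) 1)"
proof (rule max_attained_at_powersI)
  \<comment> \<open>Since \<open>9 * k = 4 * (2 * k) + k\<close> and \<open>k \<le> n mod 4\<close>,
    removing the nines needs no borrowing: the quotient by \<open>4\<close> drops by exactly
    \<open>2 * k\<close>.\<close>
  have "n - 9 * k = (n mod 4 - k) + 4 * (n div 4 - 2 * k)" "2 * k \<le> n div 4"
    using assms mult_div_mod_eq[of 4 n] mod_less_divisor[of 4 n] by linarith+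
  then have div_eq: "2 * k + (n - 9 * k) div 4 = n div 4" by simp
  let ?M = "replicate_mset k 9 + replicate_mset ((n - 9 * k) div 4) 4
      + replicate_mset (n - 4 * ((n - 9 * k) div 4) - 9 * k) 1 :: nat multiset"
  show "?M \<in> A_partitions (powers 2) n"
  proof (rule A_partitions_eqI)
    let ?a = "(n - 9 * k) div 4"
    show "?M \<in> A_partitions (powers 2) (k * 9 + ?a * 4 + (n - 4 * ?a - 9 * k) * 1)"
      by (intro plus_in_A_partitions replicate_in_A_partitions one_in_powers four_nine_in_powers)
        simp_all
    show "k * 9 + ?a * 4 + (n - 4 * ?a - 9 * k) * 1 = n"
      using assms(1) div_times_less_eq_dividend[of "n - 9 * k" 4] by linarith
  qed
  have "p (powers 2) 4 = 2" using p_powers_two_power[of 2] by simp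
  then have "p_ext (powers 2) ?M = 2 ^ (2 * k + (n - 9 * k) div 4)"
    by (simp add: p_ext_plus p_ext_replicate p_powers_two_nine p_powers_one[simplified]
        power_add power_mult)
  then show "p_ext (powers 2) ?M = 2 ^ (n div 2\<^sup>2)" using div_eq by simp
qed simp

theorem theorem5p3:
  fixes d n :: nat
  assumes "d \<ge> 2" and "n > 0"
  shows
    "(d \<ge> 3 \<longrightarrow>
        max_attained_at (powers d) n
          (replicate_mset (n div 2 ^ d) (2 ^ d) + replicate_mset (n - 2 ^ d * (n div 2 ^ d)) 1)) \<and>
     (d = 2 \<longrightarrow>
        max_attained_at (powers d) n
          (replicate_mset (n div 4) 4 + replicate_mset (n - 4 * (n div 4)) 1) \<and>
        (n mod 4 \<in> {1, 2, 3} \<and> n \<ge> 9 \<longrightarrow>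
          max_attained_at (powers d) n
            ({#9#} + replicate_mset ((n - 9) div 4) 4
              + replicate_mset (n - 4 * ((n - 9) div 4) - 9) 1)) \<and>
        (n mod 4 \<in> {2, 3} \<and> n \<ge> 18 \<longrightarrow>
          max_attained_at (powers d) n
            (replicate_mset 2 9 + replicate_mset ((n - 18) div 4) 4
              + replicate_mset (n - 4 * ((n - 18) div 4) - 18) 1)) \<and>
        (n mod 4 = 3 \<and> n \<ge> 27 \<longrightarrow>
          max_attained_at (powers d) n
            (replicate_mset 3 9 + replicate_mset ((n - 27) div 4) 4
              + replicate_mset (n - 4 * ((n - 27) div 4) - 27) 1))) \<and>
     max_p (powers d) n = 2 ^ (n div 2 ^ d)"
proof -
  let ?M = "replicate_mset (n div 2 ^ d) (2 ^ d) + replicate_mset (n - 2 ^ d * (n div 2 ^ d)) 1"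
  have M: "?M \<in> A_partitions (powers d) n" "p_ext (powers d) ?M = 2 ^ (n div 2 ^ d)"
    using replicate_partition_in_A_partitions[of n d] p_ext_replicate_partition[of d n] assms(1)
    by simp_all
  \<comment> \<open>The four families for squares are the cases \<open>k = 0, 1, 2, 3\<close>; the
    residue conditions say \<open>k \<le> n mod 4\<close>.\<close>
  have "max_attained_at (powers 2) n
      (replicate_mset (n div 4) 4 + replicate_mset (n - 4 * (n div 4)) 1)"
    using max_attained_at_squares[of 0 n] by simp
  moreover have "max_attained_at (powers 2) n
      ({#9#} + replicate_mset ((n - 9) div 4) 4 + replicate_mset (n - 4 * ((n - 9) div 4) - 9) 1)"
    if "n mod 4 \<in> {1, 2, 3} \<and> n \<ge> 9"
    using that max_attained_at_squares[of 1 n]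
    by auto
  moreover have "max_attained_at (powers 2) n
      (replicate_mset 2 9 + replicate_mset ((n - 18) div 4) 4
        + replicate_mset (n - 4 * ((n - 18) div 4) - 18) 1)"
    if "n mod 4 \<in> {2, 3} \<and> n \<ge> 18"
    using that max_attained_at_squares[of 2 n]
    by auto
  moreover have "max_attained_at (powers 2) n
      (replicate_mset 3 9 + replicate_mset ((n - 27) div 4) 4
        + replicate_mset (n - 4 * ((n - 27) div 4) - 27) 1)"
    if "n mod 4 = 3 \<and> n \<ge> 27"
    using that max_attained_at_squares[of 3 n]
    by auto
  ultimately show ?thesis
    using max_attained_at_powersI[OF assms(1) M] max_p_powers_eqI[OF assms(1) M] by blast
qed

end
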